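(* Let $C$ be a category and $x$ an object in $C$. The following are equivalent: (a) $\pi_0(C/x) = \{[x]\}$ and $\pi_1(C/x) = \{[x]\}$; (b) $x$ is a terminal object in $C$.
   Context: Composition is written in diagrammatic order: $f;g$ means first $f$, then $g$. Poset reflection: for a category $C$, $\|C\|$ is the poset whose elements are equivalence classes $\|x\|$ of objects $x$ of $C$, with $\|x\|=\|y\|$ iff there exist morphisms $x\to y$ and $y\to x$, and $\|x\|\le\|y\|$ iff there exists a morphism $x\to y$ in $C$. This is functorial in $C$. Zeroth homotopy poset: for an object $x$ of $C$, the functor $\mathrm{dom}\colon C/x\to C$ from the slice category induces an order-preserving map $\|\mathrm{dom}\|\colon \|C/x\|\to\|C\|$. The pointed poset $(\pi_0(C/x),[x])$ is the quotient of $\|C\|$ by this map, i.e. the pushout in the category of posets of $\|\mathrm{dom}\|$ along the unique map $\|C/x\|\to 1$ to the one-element poset, pointed with the image $[x]$ of the element of $1$. Explicitly, an element of $\pi_0(C/x)$ is either $[x]$, or $\|y\|$ for an object $y$ such that there is no morphism $y\to x$; the order is: $[x]\le[x]$; $[x]\le\|y\|$ iff there is a span $x\leftarrow z\to y$ in $C$; never $\|y\|\le[x]$; and $\|y\|\le\|z\|$ iff there is a morphism $y\to z$. Category of parallel arrows: $\mathrm{Par}(C/x)$ has as objects the pairs $(f_0,f_1\colon y\to x)$ of parallel morphisms with codomain $x$; a morphism $(f_0,f_1\colon y\to x)\to(g_0,g_1\colon z\to x)$ is a morphism $h\colon y\to z$ with $f_0=h;g_0$ and $f_1=h;g_1$.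 First homotopy poset: $(\pi_1(C/x),[x])$ is the pointed poset $\bigl(\pi_0(\mathrm{Par}(C/x)/(\mathrm{id}_x,\mathrm{id}_x)),[(\mathrm{id}_x,\mathrm{id}_x)]\bigr)$, i.e. the zeroth homotopy poset of the category $\mathrm{Par}(C/x)$ over its object $(\mathrm{id}_x,\mathrm{id}_x)$. *)

theory Defs
  imports "HOL-Algebra.Order"
begin

section \<open>Categories\<close>

text \<open>Composition is diagrammatic: \<open>f \<Zsemi> g\<close> is first \<open>f\<close>, then \<open>g\<close>.\<close>

record ('o, 'a) category =
  Obj :: "'o set"
  Arr :: "'a set"
  Dom :: "'a \<Rightarrow> 'o"
  Cod :: "'a \<Rightarrow> 'o"
  Ident :: "'o \<Rightarrow> 'a"
  Seq :: "'a \<Rightarrow> 'a \<Rightarrow> 'a"  (infixl \<open>\<Zsemi>\<index>\<close> 70)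

definition Hom :: "('o, 'a) category \<Rightarrow> 'o \<Rightarrow> 'o \<Rightarrow> 'a set" where
  "Hom C y z = {h \<in> Arr C. Dom C h = y \<and> Cod C h = z}"

locale category =
  fixes C :: "('o, 'a) category" (structure)
  assumes Dom_in: "f \<in> Arr C \<Longrightarrow> Dom C f \<in> Obj C"
    and Cod_in: "f \<in> Arr C \<Longrightarrow> Cod C f \<in> Obj C"
    and Ident_in: "y \<in> Obj C \<Longrightarrow> Ident C y \<in> Hom C y y"
    and Seq_in: "\<lbrakk>f \<in> Hom C w y; g \<in> Hom C y z\<rbrakk> \<Longrightarrow> f \<Zsemi> g \<in> Hom C w z"
    and Ident_left: "f \<in> Hom C y z \<Longrightarrow> Ident C y \<Zsemi> f = f"
    and Ident_right: "f \<in> Hom C y z \<Longrightarrow> f \<Zsemi> Ident C z = f"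
    and Seq_assoc: "\<lbrakk>f \<in> Hom C v w; g \<in> Hom C w y; h \<in> Hom C y z\<rbrakk>
      \<Longrightarrow> (f \<Zsemi> g) \<Zsemi> h = f \<Zsemi> (g \<Zsemi> h)"

definition terminal :: "('o, 'a) category \<Rightarrow> 'o \<Rightarrow> bool" where
  "terminal C x \<longleftrightarrow> x \<in> Obj C \<and> (\<forall>y \<in> Obj C. \<exists>!h. h \<in> Hom C y x)"

locale cat_functor = source: category C + target: category D
  for C :: "('o, 'a) category" and D :: "('p, 'b) category" +
  fixes Fo :: "'o \<Rightarrow> 'p" and Fa :: "'a \<Rightarrow> 'b"
  assumes Fo_in: "y \<in> Obj C \<Longrightarrow> Fo y \<in> Obj D"
    and Fa_in: "h \<in> Hom C y z \<Longrightarrow> Fa h \<in> Hom D (Fo y) (Fo z)"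
    and Fa_Ident: "y \<in> Obj C \<Longrightarrow> Fa (Ident C y) = Ident D (Fo y)"
    and Fa_Seq: "\<lbrakk>f \<in> Hom C w y; g \<in> Hom C y z\<rbrakk> \<Longrightarrow> Fa (f \<Zsemi>\<^bsub>C\<^esub> g) = Fa f \<Zsemi>\<^bsub>D\<^esub> Fa g"


section \<open>Slices and parallel arrows\<close>

text \<open>
  An object of the slice over \<open>x\<close> is an arrow with codomain \<open>x\<close>. A morphism \<open>f \<rightarrow> g\<close> given by
  \<open>h\<close> is the triple \<open>(f, h, g)\<close>, so that it determines its domain and codomain.
\<close>

definition slice :: "('o, 'a) category \<Rightarrow> 'o \<Rightarrow> ('a, 'a \<times> 'a \<times> 'a) category" where
  "slice C x = \<lparr>
     Obj = {f \<in> Arr C. Cod C f = x},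
     Arr = {(f, h, g). f \<in> Arr C \<and> Cod C f = x \<and> g \<in> Arr C \<and> Cod C g = x \<and>
                       h \<in> Hom C (Dom C f) (Dom C g) \<and> f = h \<Zsemi>\<^bsub>C\<^esub> g},
     Dom = (\<lambda>(f, h, g). f),
     Cod = (\<lambda>(f, h, g). g),
     Ident = (\<lambda>f. (f, Ident C (Dom C f), f)),
     Seq = (\<lambda>(f, h, g) (f', h', g'). (f, h \<Zsemi>\<^bsub>C\<^esub> h', g')) \<rparr>"

text \<open>The forgetful functor \<open>dom\<close> from the slice is \<^term>\<open>Dom C\<close> on objects.\<close>

definition dom_arr :: "'a \<times> 'a \<times> 'a \<Rightarrow> 'a" where
  "dom_arr = (\<lambda>(f, h, g). h)"

definition Par :: "('o, 'a) category \<Rightarrow> 'o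
    \<Rightarrow> ('a \<times> 'a, ('a \<times> 'a) \<times> 'a \<times> ('a \<times> 'a)) category" where
  "Par C x = (let P = {(f0, f1). \<exists>y. f0 \<in> Hom C y x \<and> f1 \<in> Hom C y x} in \<lparr>
     Obj = P,
     Arr = {((f0, f1), h, (g0, g1)). (f0, f1) \<in> P \<and> (g0, g1) \<in> P \<and>
              h \<in> Hom C (Dom C f0) (Dom C g0) \<and> f0 = h \<Zsemi>\<^bsub>C\<^esub> g0 \<and> f1 = h \<Zsemi>\<^bsub>C\<^esub> g1},
     Dom = (\<lambda>(f, h, g). f),
     Cod = (\<lambda>(f, h, g). g),
     Ident = (\<lambda>(f0, f1). ((f0, f1), Ident C (Dom C f0), (f0, f1))),
     Seq = (\<lambda>(f, h, g) (f', h', g'). (f, h \<Zsemi>\<^bsub>C\<^esub> h', g')) \<rparr>)"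

lemma slice_simps:
  "Obj (slice C x) = {f \<in> Arr C. Cod C f = x}"
  "Dom (slice C x) (f, h, g) = f"
  "Cod (slice C x) (f, h, g) = g"
  "Ident (slice C x) f = (f, Ident C (Dom C f), f)"
  "(f, h, g) \<Zsemi>\<^bsub>slice C x\<^esub> (f', h', g') = (f, h \<Zsemi>\<^bsub>C\<^esub> h', g')"
  by (simp_all add: slice_def)

lemma Arr_slice: "t \<in> Arr (slice C x) \<longleftrightarrow> (\<exists>f h g. t = (f, h, g) \<and> f \<in> Obj (slice C x) \<and>
    g \<in> Obj (slice C x) \<and> h \<in> Hom C (Dom C f) (Dom C g) \<and> f = h \<Zsemi>\<^bsub>C\<^esub> g)"
  by (auto simp: slice_def)

lemma Hom_slice: "t \<in> Hom (slice C x) f g \<longleftrightarrow> (\<exists>h. t = (f, h, g) \<and> f \<in> Obj (slice C x) \<and>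
    g \<in> Obj (slice C x) \<and> h \<in> Hom C (Dom C f) (Dom C g) \<and> f = h \<Zsemi>\<^bsub>C\<^esub> g)"
  unfolding Hom_def[of "slice C x"] by (auto simp: Arr_slice slice_simps)

lemma Obj_slice: "f \<in> Obj (slice C x) \<longleftrightarrow> f \<in> Hom C (Dom C f) x"
  by (simp add: slice_simps Hom_def)

lemma category_slice:
  assumes "category C"
  shows "category (slice C x)"
proof -
  interpret category C by fact
  let ?S = "slice C x"
  show ?thesis
  proof
    show "Dom ?S t \<in> Obj ?S" "Cod ?S t \<in> Obj ?S" if "t \<in> Arr ?S" for t
      using that unfolding Arr_slice by (force simp only: slice_simps(2,3))+
    show "Ident ?S f \<in> Hom ?S f f" if "f \<in> Obj ?S" for f
    proof -
      have "f \<in> Hom C (Dom C f) x" "Dom C f \<in> Obj C"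
        using that Dom_in by (auto simp: slice_simps Hom_def)
      then show ?thesis
        using that Ident_in Ident_left by (simp add: Hom_slice slice_simps(4))
    qed
    show "s \<Zsemi>\<^bsub>?S\<^esub> t \<in> Hom ?S f k" if st: "s \<in> Hom ?S f g" "t \<in> Hom ?S g k" for s t f g k
    proof -
      obtain h l where h: "s = (f, h, g)" "h \<in> Hom C (Dom C f) (Dom C g)" "f = h \<Zsemi>\<^bsub>C\<^esub> g"
        and l: "t = (g, l, k)" "l \<in> Hom C (Dom C g) (Dom C k)" "g = l \<Zsemi>\<^bsub>C\<^esub> k"
        and obj: "f \<in> Obj ?S" "k \<in> Obj ?S"
        using st unfolding Hom_slice by blast
      have "f = (h \<Zsemi>\<^bsub>C\<^esub> l) \<Zsemi>\<^bsub>C\<^esub> k"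
        using Seq_assoc[OF h(2) l(2)] h(3) l(3) obj(2)[unfolded Obj_slice] by simp
      then show ?thesis
        using Seq_in[OF h(2) l(2)] obj unfolding Hom_slice h(1) l(1) slice_simps(5) by blast
    qed
    show "Ident ?S f \<Zsemi>\<^bsub>?S\<^esub> t = t" "t \<Zsemi>\<^bsub>?S\<^esub> Ident ?S g = t" if "t \<in> Hom ?S f g" for t f g
      using that Ident_left Ident_right unfolding Hom_slice by (force simp only: slice_simps(4,5))+
    show "(s \<Zsemi>\<^bsub>?S\<^esub> t) \<Zsemi>\<^bsub>?S\<^esub> u = s \<Zsemi>\<^bsub>?S\<^esub> (t \<Zsemi>\<^bsub>?S\<^esub> u)"
      if stu: "s \<in> Hom ?S f g" "t \<in> Hom ?S g k" "u \<in> Hom ?S k l" for s t u f g k l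
    proof -
      obtain h h' h'' where "s = (f, h, g)" "t = (g, h', k)" "u = (k, h'', l)"
          "h \<in> Hom C (Dom C f) (Dom C g)" "h' \<in> Hom C (Dom C g) (Dom C k)"
          "h'' \<in> Hom C (Dom C k) (Dom C l)"
        using stu unfolding Hom_slice by blast
      then show ?thesis
        using Seq_assoc by (simp only: slice_simps(5))
    qed
  qed
qed

lemma cat_functor_dom:
  assumes "category C"
  shows "cat_functor (slice C x) C (Dom C) dom_arr"
proof -
  interpret category C by fact
  interpret S: category "slice C x" by (rule category_slice) fact
  show ?thesis
  proof
    show "Dom C f \<in> Obj C" if "f \<in> Obj (slice C x)" for f
      using that Dom_in by (simp add: slice_simps)
  qed (auto simp: Hom_slice slice_simps(4,5) dom_arr_def)
qed

lemma Par_simps: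
  "Obj (Par C x) = {(f0, f1). \<exists>y. f0 \<in> Hom C y x \<and> f1 \<in> Hom C y x}"
  "Dom (Par C x) (p, h, q) = p"
  "Cod (Par C x) (p, h, q) = q"
  "Ident (Par C x) p = (p, Ident C (Dom C (fst p)), p)"
  "(p, h, q) \<Zsemi>\<^bsub>Par C x\<^esub> (p', h', q') = (p, h \<Zsemi>\<^bsub>C\<^esub> h', q')"
  by (simp_all add: Par_def Let_def split: prod.split)

lemma Arr_Par: "t \<in> Arr (Par C x) \<longleftrightarrow> (\<exists>p h q. t = (p, h, q) \<and> p \<in> Obj (Par C x) \<and>
    q \<in> Obj (Par C x) \<and> h \<in> Hom C (Dom C (fst p)) (Dom C (fst q)) \<and>
    fst p = h \<Zsemi>\<^bsub>C\<^esub> fst q \<and> snd p = h \<Zsemi>\<^bsub>C\<^esub> snd q)"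
  unfolding Par_def Let_def by auto

lemma Hom_Par: "t \<in> Hom (Par C x) p q \<longleftrightarrow> (\<exists>h. t = (p, h, q) \<and> p \<in> Obj (Par C x) \<and>
    q \<in> Obj (Par C x) \<and> h \<in> Hom C (Dom C (fst p)) (Dom C (fst q)) \<and>
    fst p = h \<Zsemi>\<^bsub>C\<^esub> fst q \<and> snd p = h \<Zsemi>\<^bsub>C\<^esub> snd q)"
  unfolding Hom_def[of "Par C x"] mem_Collect_eq Arr_Par by (force simp only: Par_simps(2,3))

lemma Obj_Par: "p \<in> Obj (Par C x) \<longleftrightarrow>
    fst p \<in> Hom C (Dom C (fst p)) x \<and> snd p \<in> Hom C (Dom C (fst p)) x"
  by (auto simp: Par_simps(1) Hom_def split: prod.splits)

lemma category_Par:
  assumes "category C"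
  shows "category (Par C x)"
proof -
  interpret category C by fact
  let ?S = "Par C x"
  show ?thesis
  proof
    show "Dom ?S t \<in> Obj ?S" "Cod ?S t \<in> Obj ?S" if "t \<in> Arr ?S" for t
      using that unfolding Arr_Par by (force simp only: Par_simps(2,3))+
    show "Ident ?S p \<in> Hom ?S p p" if "p \<in> Obj ?S" for p
    proof -
      have "fst p \<in> Hom C (Dom C (fst p)) x" "snd p \<in> Hom C (Dom C (fst p)) x"
        using that unfolding Obj_Par by auto
      moreover from this have "Dom C (fst p) \<in> Obj C"
        using Dom_in by (auto simp: Hom_def)
      ultimately show ?thesis
        using that Ident_in Ident_left by (simp add: Hom_Par Par_simps(4))
    qed
    show "s \<Zsemi>\<^bsub>?S\<^esub> t \<in> Hom ?S p r" if st: "s \<in> Hom ?S p q" "t \<in> Hom ?S q r" for s t p q r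
    proof -
      obtain h l where h: "s = (p, h, q)" "h \<in> Hom C (Dom C (fst p)) (Dom C (fst q))"
          "fst p = h \<Zsemi>\<^bsub>C\<^esub> fst q" "snd p = h \<Zsemi>\<^bsub>C\<^esub> snd q"
        and l: "t = (q, l, r)" "l \<in> Hom C (Dom C (fst q)) (Dom C (fst r))"
          "fst q = l \<Zsemi>\<^bsub>C\<^esub> fst r" "snd q = l \<Zsemi>\<^bsub>C\<^esub> snd r"
        and obj: "p \<in> Obj ?S" "r \<in> Obj ?S"
        using st unfolding Hom_Par by blast
      have "fst p = (h \<Zsemi>\<^bsub>C\<^esub> l) \<Zsemi>\<^bsub>C\<^esub> fst r" "snd p = (h \<Zsemi>\<^bsub>C\<^esub> l) \<Zsemi>\<^bsub>C\<^esub> snd r"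
        using Seq_assoc[OF h(2) l(2), of "fst r" x] Seq_assoc[OF h(2) l(2), of "snd r" x]
          h(3,4) l(3,4) obj(2)[unfolded Obj_Par] by simp_all
      then show ?thesis
        using Seq_in[OF h(2) l(2)] obj unfolding Hom_Par h(1) l(1) Par_simps(5) by blast
    qed
    show "Ident ?S p \<Zsemi>\<^bsub>?S\<^esub> t = t" "t \<Zsemi>\<^bsub>?S\<^esub> Ident ?S q = t" if "t \<in> Hom ?S p q" for t p q
      using that Ident_left Ident_right unfolding Hom_Par by (force simp only: Par_simps(4,5))+
    show "(s \<Zsemi>\<^bsub>?S\<^esub> t) \<Zsemi>\<^bsub>?S\<^esub> u = s \<Zsemi>\<^bsub>?S\<^esub> (t \<Zsemi>\<^bsub>?S\<^esub> u)"
      if stu: "s \<in> Hom ?S p q" "t \<in> Hom ?S q r" "u \<in> Hom ?S r v" for s t u p q r v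
    proof -
      obtain h h' h'' where "s = (p, h, q)" "t = (q, h', r)" "u = (r, h'', v)"
          "h \<in> Hom C (Dom C (fst p)) (Dom C (fst q))" "h' \<in> Hom C (Dom C (fst q)) (Dom C (fst r))"
          "h'' \<in> Hom C (Dom C (fst r)) (Dom C (fst v))"
        using stu unfolding Hom_Par by blast
      then show ?thesis
        using Seq_assoc by (simp only: Par_simps(5))
    qed
  qed
qed


section \<open>Poset reflection\<close>

definition refl_class :: "'a set \<Rightarrow> ('a \<Rightarrow> 'a \<Rightarrow> bool) \<Rightarrow> 'a \<Rightarrow> 'a set" where
  "refl_class A r a = {b \<in> A. r a b \<and> r b a}"

definition poset_reflection :: "'a set \<Rightarrow> ('a \<Rightarrow> 'a \<Rightarrow> bool) \<Rightarrow> 'a set gorder" where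
  "poset_reflection A r = \<lparr>
     carrier = refl_class A r ` A,
     eq = (=),
     le = (\<lambda>X Y. \<exists>a \<in> X. \<exists>b \<in> Y. r a b) \<rparr>"

definition arrow_le :: "('o, 'a) category \<Rightarrow> 'o \<Rightarrow> 'o \<Rightarrow> bool" where
  "arrow_le C y z \<longleftrightarrow> Hom C y z \<noteq> {}"

definition cat_class :: "('o, 'a) category \<Rightarrow> 'o \<Rightarrow> 'o set" where
  "cat_class C = refl_class (Obj C) (arrow_le C)"

definition cat_poset :: "('o, 'a) category \<Rightarrow> 'o set gorder" where
  "cat_poset C = poset_reflection (Obj C) (arrow_le C)"

text \<open>
  The map induced by a functor into \<open>D\<close> with object part \<open>Fo\<close>. The union runs over equal
  sets, see \<open>cat_poset_map_class\<close> below.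
\<close>

definition cat_poset_map :: "('p, 'b) category \<Rightarrow> ('o \<Rightarrow> 'p) \<Rightarrow> 'o set \<Rightarrow> 'p set" where
  "cat_poset_map D Fo X = (\<Union>y \<in> X. cat_class D (Fo y))"

definition preorder_on_set :: "'a set \<Rightarrow> ('a \<Rightarrow> 'a \<Rightarrow> bool) \<Rightarrow> bool" where
  "preorder_on_set A r \<longleftrightarrow> reflp_on A r \<and> transp_on A r"

lemma preorder_refl: "\<lbrakk>preorder_on_set A r; a \<in> A\<rbrakk> \<Longrightarrow> r a a"
  by (simp add: preorder_on_set_def reflp_on_def)

lemma preorder_trans:
  "\<lbrakk>preorder_on_set A r; a \<in> A; b \<in> A; c \<in> A; r a b; r b c\<rbrakk> \<Longrightarrow> r a c"
  unfolding preorder_on_set_def by (elim conjE transp_onD)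

lemma refl_class_eq_iff:
  assumes "preorder_on_set A r" "a \<in> A" "b \<in> A"
  shows "refl_class A r a = refl_class A r b \<longleftrightarrow> r a b \<and> r b a"
proof
  assume eq: "refl_class A r a = refl_class A r b"
  have "b \<in> refl_class A r b"
    using assms preorder_refl by (simp add: refl_class_def)
  then show "r a b \<and> r b a"
    unfolding eq[symmetric] by (simp add: refl_class_def)
next
  assume ab: "r a b \<and> r b a"
  have tr: "\<lbrakk>x \<in> A; y \<in> A; z \<in> A; r x y; r y z\<rbrakk> \<Longrightarrow> r x z" for x y z
    using assms(1) by (rule preorder_trans)
  have "r a c \<and> r c a \<longleftrightarrow> r b c \<and> r c b" if "c \<in> A" for c
    using tr[of a b c] tr[of b a c] tr[of c a b] tr[of c b a] ab assms(2,3) that by blast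
  then show "refl_class A r a = refl_class A r b"
    by (auto simp: refl_class_def)
qed

lemma poset_reflection_le_iff:
  assumes "preorder_on_set A r" "a \<in> A" "b \<in> A"
  shows "refl_class A r a \<sqsubseteq>\<^bsub>poset_reflection A r\<^esub> refl_class A r b \<longleftrightarrow> r a b"
proof
  have tr: "\<lbrakk>x \<in> A; y \<in> A; z \<in> A; r x y; r y z\<rbrakk> \<Longrightarrow> r x z" for x y z
    using assms(1) by (rule preorder_trans)
  assume "refl_class A r a \<sqsubseteq>\<^bsub>poset_reflection A r\<^esub> refl_class A r b"
  then obtain c d where "c \<in> A" "d \<in> A" "r a c" "r c d" "r d b"
    by (auto simp: poset_reflection_def refl_class_def)
  then show "r a b"
    using tr[of a c d] tr[of a d b] assms(2,3) by blast
next
  assume "r a b"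
  moreover have "a \<in> refl_class A r a" "b \<in> refl_class A r b"
    using assms preorder_refl by (simp_all add: refl_class_def)
  ultimately show "refl_class A r a \<sqsubseteq>\<^bsub>poset_reflection A r\<^esub> refl_class A r b"
    by (auto simp: poset_reflection_def)
qed

lemma partial_order_poset_reflection:
  assumes pre: "preorder_on_set A r"
  shows "partial_order (poset_reflection A r)"
proof -
  let ?L = "poset_reflection A r"
  have car: "carrier ?L = refl_class A r ` A" and eq: "eq ?L = (=)"
    by (simp_all add: poset_reflection_def)
  have tr: "\<lbrakk>a \<in> A; b \<in> A; c \<in> A; r a b; r b c\<rbrakk> \<Longrightarrow> r a c" for a b c
    using pre by (rule preorder_trans)
  have rf: "a \<in> A \<Longrightarrow> r a a" for a
    using pre by (rule preorder_refl)
  have anti: "X = Y"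
    if h: "X \<in> carrier ?L" "Y \<in> carrier ?L" "X \<sqsubseteq>\<^bsub>?L\<^esub> Y" "Y \<sqsubseteq>\<^bsub>?L\<^esub> X" for X Y
  proof -
    obtain a b where ab: "X = refl_class A r a" "Y = refl_class A r b" "a \<in> A" "b \<in> A"
      using h(1,2) unfolding car by blast
    have "r a b" "r b a"
      using h(3,4) ab poset_reflection_le_iff[OF pre] by metis+
    then show ?thesis
      unfolding ab(1,2) by (simp only: refl_class_eq_iff[OF pre] ab)
  qed
  have trans: "X \<sqsubseteq>\<^bsub>?L\<^esub> Z"
    if h: "X \<in> carrier ?L" "Y \<in> carrier ?L" "Z \<in> carrier ?L" "X \<sqsubseteq>\<^bsub>?L\<^esub> Y" "Y \<sqsubseteq>\<^bsub>?L\<^esub> Z" for X Y Z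
  proof -
    obtain a b c where abc: "X = refl_class A r a" "Y = refl_class A r b" "Z = refl_class A r c"
        "a \<in> A" "b \<in> A" "c \<in> A"
      using h(1-3) unfolding car by blast
    have "r a b" "r b c"
      using h(4,5) abc poset_reflection_le_iff[OF pre] by metis+
    then show ?thesis
      using tr[OF abc(4-6)] unfolding abc(1,3) by (simp only: poset_reflection_le_iff[OF pre] abc)
  qed
  have refl: "X \<sqsubseteq>\<^bsub>?L\<^esub> X" if "X \<in> carrier ?L" for X
    using that rf poset_reflection_le_iff[OF pre] unfolding car by (elim imageE) simp
  show ?thesis
  proof
    show "X .=\<^bsub>?L\<^esub> Y"
      if "X \<sqsubseteq>\<^bsub>?L\<^esub> Y" "Y \<sqsubseteq>\<^bsub>?L\<^esub> X" "X \<in> carrier ?L" "Y \<in> carrier ?L" for X Y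
      unfolding eq using that(3,4,1,2) by (rule anti)
    show "X \<sqsubseteq>\<^bsub>?L\<^esub> Z"
      if "X \<sqsubseteq>\<^bsub>?L\<^esub> Y" "Y \<sqsubseteq>\<^bsub>?L\<^esub> Z" "X \<in> carrier ?L" "Y \<in> carrier ?L" "Z \<in> carrier ?L" for X Y Z
      using that(3,4,5,1,2) by (rule trans)
  qed (simp_all add: eq refl)
qed

lemma preorder_arrow_le:
  assumes "category C"
  shows "preorder_on_set (Obj C) (arrow_le C)"
  unfolding preorder_on_set_def
proof
  show "reflp_on (Obj C) (arrow_le C)"
    using category.Ident_in[OF assms] unfolding arrow_le_def by (intro reflp_onI) blast
  show "transp_on (Obj C) (arrow_le C)"
    using category.Seq_in[OF assms] unfolding arrow_le_def by (intro transp_onI) blast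
qed

lemma partial_order_cat_poset: "category C \<Longrightarrow> partial_order (cat_poset C)"
  unfolding cat_poset_def by (intro partial_order_poset_reflection preorder_arrow_le)

lemma cat_class_eq_iff:
  assumes "category C" "y \<in> Obj C" "z \<in> Obj C"
  shows "cat_class C y = cat_class C z \<longleftrightarrow> Hom C y z \<noteq> {} \<and> Hom C z y \<noteq> {}"
  using refl_class_eq_iff[OF preorder_arrow_le assms(2,3), OF assms(1)]
  by (simp add: cat_class_def arrow_le_def)

lemma cat_poset_le_iff:
  assumes "category C" "y \<in> Obj C" "z \<in> Obj C"
  shows "cat_class C y \<sqsubseteq>\<^bsub>cat_poset C\<^esub> cat_class C z \<longleftrightarrow> Hom C y z \<noteq> {}"
  using poset_reflection_le_iff[OF preorder_arrow_le assms(2,3), OF assms(1)]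
  by (simp add: cat_class_def cat_poset_def arrow_le_def)

lemma carrier_cat_poset: "carrier (cat_poset C) = cat_class C ` Obj C"
  by (simp add: cat_poset_def cat_class_def poset_reflection_def)

lemma (in cat_functor) cat_poset_map_class:
  assumes "y \<in> Obj C"
  shows "cat_poset_map D Fo (cat_class C y) = cat_class D (Fo y)"
proof -
  have "cat_class D (Fo z) = cat_class D (Fo y)" if "z \<in> cat_class C y" for z
  proof -
    have z: "z \<in> Obj C" "Hom C y z \<noteq> {}" "Hom C z y \<noteq> {}"
      using that by (auto simp: cat_class_def refl_class_def arrow_le_def)
    then have "Hom D (Fo y) (Fo z) \<noteq> {}" "Hom D (Fo z) (Fo y) \<noteq> {}"
      using Fa_in by blast+
    then show ?thesis
      using cat_class_eq_iff[OF target.category_axioms] Fo_in z(1) assms by blast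
  qed
  moreover have "y \<in> cat_class C y"
    using source.Ident_in[OF assms] assms
    by (auto simp: cat_class_def refl_class_def arrow_le_def)
  ultimately show ?thesis
    unfolding cat_poset_map_def by blast
qed

lemma (in cat_functor) isotone_cat_poset_map:
  "isotone (cat_poset C) (cat_poset D) (cat_poset_map D Fo)"
proof
  show "weak_partial_order (cat_poset C)" "weak_partial_order (cat_poset D)"
    using partial_order_cat_poset source.category_axioms target.category_axioms
    by (auto simp: partial_order_def)
next
  fix X Y
  assume "X \<in> carrier (cat_poset C)" "Y \<in> carrier (cat_poset C)" and le: "X \<sqsubseteq>\<^bsub>cat_poset C\<^esub> Y"
  then obtain y z where yz: "X = cat_class C y" "Y = cat_class C z" "y \<in> Obj C" "z \<in> Obj C"
    by (auto simp: carrier_cat_poset)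
  then have "Hom C y z \<noteq> {}"
    using le cat_poset_le_iff[OF source.category_axioms] by blast
  then have "Hom D (Fo y) (Fo z) \<noteq> {}"
    using Fa_in by blast
  then show "cat_poset_map D Fo X \<sqsubseteq>\<^bsub>cat_poset D\<^esub> cat_poset_map D Fo Y"
    using cat_poset_le_iff[OF target.category_axioms] Fo_in yz
    by (simp add: cat_poset_map_class)
qed


section \<open>Quotient of a poset by an order-preserving map\<close>

text \<open>
  The pushout of \<open>f : Q \<rightarrow> P\<close> along the map from \<open>Q\<close> to the one-element poset. On the disjoint
  union of \<open>P\<close> with a point \<^const>\<open>None\<close>, take the least preorder that extends the two orders
  and identifies \<open>f q\<close> with \<^const>\<open>None\<close> for all \<open>q\<close> in \<open>Q\<close>; then reflect into posets. The
  universal property is \<open>poset_quotient_universal\<close>.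
\<close>

inductive quot_le :: "'p gorder \<Rightarrow> 'q gorder \<Rightarrow> ('q \<Rightarrow> 'p) \<Rightarrow> 'p option \<Rightarrow> 'p option \<Rightarrow> bool"
  for P Q f where
  point: "quot_le P Q f None None"
| order: "\<lbrakk>p \<in> carrier P; p' \<in> carrier P; p \<sqsubseteq>\<^bsub>P\<^esub> p'\<rbrakk> \<Longrightarrow> quot_le P Q f (Some p) (Some p')"
| glue1: "q \<in> carrier Q \<Longrightarrow> quot_le P Q f (Some (f q)) None"
| glue2: "q \<in> carrier Q \<Longrightarrow> quot_le P Q f None (Some (f q))"
| trans: "\<lbrakk>quot_le P Q f u v; quot_le P Q f v w\<rbrakk> \<Longrightarrow> quot_le P Q f u w"

definition quot_set :: "'p gorder \<Rightarrow> 'p option set" where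
  "quot_set P = insert None (Some ` carrier P)"

definition poset_quotient :: "'p gorder \<Rightarrow> 'q gorder \<Rightarrow> ('q \<Rightarrow> 'p) \<Rightarrow> 'p option set gorder" where
  "poset_quotient P Q f = poset_reflection (quot_set P) (quot_le P Q f)"

definition quot_class :: "'p gorder \<Rightarrow> 'q gorder \<Rightarrow> ('q \<Rightarrow> 'p) \<Rightarrow> 'p option \<Rightarrow> 'p option set" where
  "quot_class P Q f = refl_class (quot_set P) (quot_le P Q f)"

lemma preorder_quot_le:
  assumes "weak_partial_order P"
  shows "preorder_on_set (quot_set P) (quot_le P Q f)"
  unfolding preorder_on_set_def
proof
  show "reflp_on (quot_set P) (quot_le P Q f)"
    using weak_partial_order.le_refl[OF assms]
    by (auto simp: quot_set_def intro!: reflp_onI quot_le.point quot_le.order)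
  show "transp_on (quot_set P) (quot_le P Q f)"
    by (intro transp_onI) (rule quot_le.trans)
qed

lemma partial_order_poset_quotient:
  "weak_partial_order P \<Longrightarrow> partial_order (poset_quotient P Q f)"
  unfolding poset_quotient_def by (intro partial_order_poset_reflection preorder_quot_le)

lemma poset_quotient_le_iff:
  assumes "weak_partial_order P" "u \<in> quot_set P" "v \<in> quot_set P"
  shows "quot_class P Q f u \<sqsubseteq>\<^bsub>poset_quotient P Q f\<^esub> quot_class P Q f v \<longleftrightarrow> quot_le P Q f u v"
  unfolding quot_class_def poset_quotient_def
  by (rule poset_reflection_le_iff) (use assms preorder_quot_le in auto)

lemma quot_class_eq_iff:
  assumes "weak_partial_order P" "u \<in> quot_set P" "v \<in> quot_set P"
  shows "quot_class P Q f u = quot_class P Q f v \<longleftrightarrow> quot_le P Q f u v \<and> quot_le P Q f v u"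
  unfolding quot_class_def
  by (rule refl_class_eq_iff) (use assms preorder_quot_le in auto)

lemma carrier_poset_quotient: "carrier (poset_quotient P Q f) = quot_class P Q f ` quot_set P"
  by (simp add: poset_quotient_def quot_class_def poset_reflection_def)

lemma poset_quotient_cocone:
  assumes f: "isotone Q P f" "f \<in> carrier Q \<rightarrow> carrier P"
  shows "isotone P (poset_quotient P Q f) (\<lambda>p. quot_class P Q f (Some p))"
    and "q \<in> carrier Q \<Longrightarrow> quot_class P Q f (Some (f q)) = quot_class P Q f None"
proof -
  have P: "weak_partial_order P"
    using f by (simp add: isotone_def)
  show "isotone P (poset_quotient P Q f) (\<lambda>p. quot_class P Q f (Some p))"
  proof
    show "weak_partial_order (poset_quotient P Q f)"
      using partial_order_poset_quotient[OF P] by (auto simp: partial_order_def)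
  qed (auto simp: P poset_quotient_le_iff[OF P] quot_set_def intro: quot_le.order)
  show "quot_class P Q f (Some (f q)) = quot_class P Q f None" if "q \<in> carrier Q"
    using that f
    by (subst quot_class_eq_iff[OF P]) (auto simp: quot_set_def intro: quot_le.glue1 quot_le.glue2)
qed

lemma poset_quotient_universal:
  fixes P :: "'p gorder" and Q :: "'q gorder" and R :: "'r gorder"
  assumes f: "isotone Q P f" "f \<in> carrier Q \<rightarrow> carrier P"
    and R: "partial_order R"
    and h: "isotone P R h" "h \<in> carrier P \<rightarrow> carrier R"
    and r: "r \<in> carrier R" "\<And>q. q \<in> carrier Q \<Longrightarrow> h (f q) = r"
  shows "\<exists>!k. k \<in> extensional (carrier (poset_quotient P Q f)) \<and>
    k \<in> carrier (poset_quotient P Q f) \<rightarrow> carrier R \<and>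
    isotone (poset_quotient P Q f) R k \<and>
    k (quot_class P Q f None) = r \<and>
    (\<forall>p \<in> carrier P. k (quot_class P Q f (Some p)) = h p)"
proof -
  interpret R: partial_order R by fact
  have P: "weak_partial_order P"
    using f by (simp add: isotone_def)
  let ?L = "poset_quotient P Q f"
  let ?c = "quot_class P Q f"
  define e where "e u = (case u of None \<Rightarrow> r | Some p \<Rightarrow> h p)" for u
  have e_in: "e u \<in> carrier R" if "u \<in> quot_set P" for u
    using that h r by (auto simp: e_def quot_set_def)
  have e_mono: "u \<in> quot_set P \<and> v \<in> quot_set P \<and> e u \<sqsubseteq>\<^bsub>R\<^esub> e v" if "quot_le P Q f u v" for u v
    using that
  proof induction
    case (trans u v w)
    then show ?case
      using R.le_trans[of "e u" "e v" "e w"] e_in by simp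
  qed (use h f r in \<open>auto simp: e_def quot_set_def isotone_def\<close>)
  define k where "k = restrict (\<lambda>X. e (SOME u. u \<in> quot_set P \<and> ?c u = X)) (carrier ?L)"
  have k: "k (?c u) = e u" if u: "u \<in> quot_set P" for u
  proof -
    let ?v = "SOME v. v \<in> quot_set P \<and> ?c v = ?c u"
    have v: "?v \<in> quot_set P \<and> ?c ?v = ?c u"
      by (rule someI[of _ u]) (use u in simp)
    then have "quot_le P Q f ?v u" "quot_le P Q f u ?v"
      using quot_class_eq_iff[OF P conjunct1[OF v] u, of Q f] by blast+
    from this[THEN e_mono] have "e ?v = e u"
      by (intro R.le_antisym e_in) simp_all
    then show ?thesis
      using u by (simp add: k_def carrier_poset_quotient)
  qed
  show ?thesis
  proof (rule ex1I[of _ k], intro conjI ballI)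
    show "k \<in> extensional (carrier ?L)"
      by (simp add: k_def)
    show "k \<in> carrier ?L \<rightarrow> carrier R"
      unfolding carrier_poset_quotient by (intro Pi_I, elim imageE) (simp add: k e_in)
    show "isotone ?L R k"
    proof
      show "weak_partial_order ?L"
        using partial_order_poset_quotient[OF P] by (auto simp: partial_order_def)
      show "weak_partial_order R"
        by unfold_locales
      show "k X \<sqsubseteq>\<^bsub>R\<^esub> k Y"
        if XY: "X \<in> carrier ?L" "Y \<in> carrier ?L" and le: "X \<sqsubseteq>\<^bsub>?L\<^esub> Y" for X Y
      proof -
        obtain u v where "X = ?c u" "Y = ?c v" "u \<in> quot_set P" "v \<in> quot_set P"
          using XY unfolding carrier_poset_quotient by blast
        then show ?thesis
          using le e_mono[of u v] by (simp add: k poset_quotient_le_iff[OF P])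
      qed
    qed
    show "k (?c None) = r"
      by (simp add: k quot_set_def e_def)
    show "k (?c (Some p)) = h p" if "p \<in> carrier P" for p
      using that by (simp add: k quot_set_def e_def)
  next
    fix k'
    assume k': "k' \<in> extensional (carrier ?L) \<and> k' \<in> carrier ?L \<rightarrow> carrier R \<and>
      isotone ?L R k' \<and> k' (?c None) = r \<and> (\<forall>p \<in> carrier P. k' (?c (Some p)) = h p)"
    show "k' = k"
    proof (rule extensionalityI)
      show "k' \<in> extensional (carrier ?L)" "k \<in> extensional (carrier ?L)"
        using k' by (auto simp: k_def)
      show "k' X = k X" if "X \<in> carrier ?L" for X
      proof -
        obtain u where u: "X = ?c u" "u \<in> quot_set P"
          using \<open>X \<in> carrier ?L\<close> unfolding carrier_poset_quotient by blast
        then have "k' X = e u"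
          using k' by (auto simp: quot_set_def e_def)
        then show ?thesis
          using u by (simp add: k)
      qed
    qed
  qed
qed


section \<open>Homotopy posets\<close>

definition pi0 :: "('o, 'a) category \<Rightarrow> 'o \<Rightarrow> 'o set option set gorder" where
  "pi0 C x =
     poset_quotient (cat_poset C) (cat_poset (slice C x)) (cat_poset_map C (Dom C))"

definition pi0_class :: "('o, 'a) category \<Rightarrow> 'o \<Rightarrow> 'o set option \<Rightarrow> 'o set option set" where
  "pi0_class C x =
     quot_class (cat_poset C) (cat_poset (slice C x)) (cat_poset_map C (Dom C))"

definition pi0_point :: "('o, 'a) category \<Rightarrow> 'o \<Rightarrow> 'o set option set" where
  "pi0_point C x = pi0_class C x None"

definition pi1 :: "('o, 'a) category \<Rightarrow> 'o \<Rightarrow> ('a \<times> 'a) set option set gorder" where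
  "pi1 C x = pi0 (Par C x) (Ident C x, Ident C x)"

definition pi1_point :: "('o, 'a) category \<Rightarrow> 'o \<Rightarrow> ('a \<times> 'a) set option set" where
  "pi1_point C x = pi0_point (Par C x) (Ident C x, Ident C x)"

text \<open>
  The explicit description of the zeroth homotopy poset. By \<open>pi0_class_eq_point_iff\<close> the
  elements other than the base point are the classes of objects without a morphism to \<open>x\<close>.
\<close>

lemma pi0_le_iff:
  assumes C: "category C" and x: "x \<in> Obj C"
  shows "pi0_point C x \<sqsubseteq>\<^bsub>pi0 C x\<^esub> pi0_point C x"
    and "y \<in> Obj C \<Longrightarrow> pi0_point C x \<sqsubseteq>\<^bsub>pi0 C x\<^esub> pi0_class C x (Some (cat_class C y))
      \<longleftrightarrow> (\<exists>z \<in> Obj C. Hom C z x \<noteq> {} \<and> Hom C z y \<noteq> {})"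
    and "y \<in> Obj C \<Longrightarrow> pi0_class C x (Some (cat_class C y)) \<sqsubseteq>\<^bsub>pi0 C x\<^esub> pi0_point C x
      \<longleftrightarrow> Hom C y x \<noteq> {}"
    and "\<lbrakk>y \<in> Obj C; z \<in> Obj C; Hom C y x = {}\<rbrakk> \<Longrightarrow>
      pi0_class C x (Some (cat_class C y)) \<sqsubseteq>\<^bsub>pi0 C x\<^esub> pi0_class C x (Some (cat_class C z))
      \<longleftrightarrow> Hom C y z \<noteq> {}"
proof -
  interpret category C by fact
  interpret F: cat_functor "slice C x" C "Dom C" dom_arr by (rule cat_functor_dom) fact
  let ?P = "cat_poset C" and ?Q = "cat_poset (slice C x)" and ?f = "cat_poset_map C (Dom C)"
  let ?cl = "\<lambda>y. Some (cat_class C y)"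
  have P: "weak_partial_order ?P"
    using partial_order_cat_poset[OF C] by (simp add: partial_order_def)
  have glue: "\<exists>y \<in> Obj C. Hom C y x \<noteq> {} \<and> ?f X = cat_class C y" if "X \<in> carrier ?Q" for X
  proof -
    obtain g where g: "g \<in> Obj (slice C x)" "X = cat_class (slice C x) g"
      using \<open>X \<in> carrier ?Q\<close> by (auto simp: carrier_cat_poset)
    then have "g \<in> Hom C (Dom C g) x" "Dom C g \<in> Obj C"
      using Dom_in by (auto simp: slice_def Hom_def)
    with g show ?thesis
      using F.cat_poset_map_class by blast
  qed
  have glued: "quot_le ?P ?Q ?f (?cl y) None" "quot_le ?P ?Q ?f None (?cl y)"
    if "Hom C y x \<noteq> {}" for y
  proof -
    obtain g where g: "g \<in> Hom C y x"
      using \<open>Hom C y x \<noteq> {}\<close> by blast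
    then have o: "g \<in> Obj (slice C x)" and y: "y = Dom C g"
      by (auto simp: slice_def Hom_def)
    have "cat_class (slice C x) g \<in> carrier ?Q"
      using o by (simp add: carrier_cat_poset)
    from quot_le.glue1[of _ ?Q ?P ?f, OF this] quot_le.glue2[of _ ?Q ?P ?f, OF this]
    show "quot_le ?P ?Q ?f (?cl y) None" "quot_le ?P ?Q ?f None (?cl y)"
      by (simp_all add: F.cat_poset_map_class[OF o] y)
  qed
  have comp: "Hom C u w \<noteq> {}" if "Hom C u v \<noteq> {}" "Hom C v w \<noteq> {}" for u v w
  proof -
    obtain f where "f \<in> Hom C u v"
      using \<open>Hom C u v \<noteq> {}\<close> by blast
    moreover obtain g where "g \<in> Hom C v w"
      using \<open>Hom C v w \<noteq> {}\<close> by blast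
    ultimately show ?thesis
      using Seq_in[of f u v g w] by blast
  qed
  have ord: "quot_le ?P ?Q ?f (?cl y) (?cl z)"
    if "y \<in> Obj C" "z \<in> Obj C" "Hom C y z \<noteq> {}" for y z
    by (rule quot_le.order) (use that cat_poset_le_iff[OF C] in \<open>auto simp: carrier_cat_poset\<close>)
  define below where "below u = (case u of None \<Rightarrow> True
      | Some X \<Rightarrow> \<exists>y \<in> Obj C. X = cat_class C y \<and> Hom C y x \<noteq> {})" for u
  define conn where "conn u = (case u of None \<Rightarrow> True
      | Some X \<Rightarrow> \<exists>y \<in> Obj C. X = cat_class C y \<and> (\<exists>z \<in> Obj C. Hom C z x \<noteq> {} \<and> Hom C z y \<noteq> {}))"
    for u
  have below_cl: "below (?cl y) \<longleftrightarrow> Hom C y x \<noteq> {}" if y: "y \<in> Obj C" for y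
  proof
    assume "below (?cl y)"
    then obtain w where w: "w \<in> Obj C" "cat_class C y = cat_class C w" "Hom C w x \<noteq> {}"
      by (auto simp: below_def)
    then have "Hom C y w \<noteq> {}"
      using cat_class_eq_iff[OF C y w(1)] by simp
    then show "Hom C y x \<noteq> {}"
      using w(3) by (rule comp)
  next
    assume "Hom C y x \<noteq> {}"
    then show "below (?cl y)"
      unfolding below_def option.case using y by blast
  qed
  have conn_cl: "conn (?cl y) \<longleftrightarrow> (\<exists>z \<in> Obj C. Hom C z x \<noteq> {} \<and> Hom C z y \<noteq> {})"
    if y: "y \<in> Obj C" for y
  proof
    assume "conn (?cl y)"
    then obtain w z where w: "w \<in> Obj C" "cat_class C y = cat_class C w"
        and z: "z \<in> Obj C" "Hom C z x \<noteq> {}" "Hom C z w \<noteq> {}"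
      by (auto simp: conn_def)
    then have "Hom C w y \<noteq> {}"
      using cat_class_eq_iff[OF C y w(1)] by simp
    then have "Hom C z y \<noteq> {}"
      by (rule comp[OF z(3)])
    then show "\<exists>z \<in> Obj C. Hom C z x \<noteq> {} \<and> Hom C z y \<noteq> {}"
      using z by blast
  next
    assume "\<exists>z \<in> Obj C. Hom C z x \<noteq> {} \<and> Hom C z y \<noteq> {}"
    then show "conn (?cl y)"
      unfolding conn_def option.case using y by blast
  qed
  have inv: "(below v \<longrightarrow> below u) \<and> (conn u \<longrightarrow> conn v) \<and>
      (\<forall>y z. y \<in> Obj C \<and> z \<in> Obj C \<and> u = ?cl y \<and> v = ?cl z \<and> \<not> below u \<longrightarrow> Hom C y z \<noteq> {}) \<and>
      (below u \<longrightarrow> conn v) \<and> u \<in> quot_set ?P \<and> v \<in> quot_set ?P"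
    if "quot_le ?P ?Q ?f u v" for u v
    using that
  proof induction
    case point
    then show ?case by (simp add: below_def conn_def quot_set_def)
  next
    case (order p p')
    then obtain y z where yz: "p = cat_class C y" "p' = cat_class C z" "y \<in> Obj C" "z \<in> Obj C"
      by (auto simp: carrier_cat_poset)
    then have yz': "Hom C y z \<noteq> {}"
      using order cat_poset_le_iff[OF C] by blast
    have 1: "Hom C z x \<noteq> {} \<longrightarrow> Hom C y x \<noteq> {}"
      using comp[OF yz'] by blast
    have 2: "Hom C w z \<noteq> {}" if "Hom C w y \<noteq> {}" for w
      using that yz' by (rule comp)
    have 3: "Hom C y' z' \<noteq> {}"
      if "y' \<in> Obj C" "z' \<in> Obj C" "p = cat_class C y'" "p' = cat_class C z'" for y' z'
      using order(3) cat_poset_le_iff[OF C that(1,2)] unfolding that(3,4) by simp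
    show ?case
    proof (intro conjI)
      show "below (Some p') \<longrightarrow> below (Some p)"
        using 1 by (simp add: yz below_cl)
      show "conn (Some p) \<longrightarrow> conn (Some p')"
        using 2 unfolding yz(1,2) conn_cl[OF yz(3)] conn_cl[OF yz(4)] by blast
      show "below (Some p) \<longrightarrow> conn (Some p')"
        using yz' yz(3) unfolding yz(1,2) below_cl[OF yz(3)] conn_cl[OF yz(4)] by blast
    qed (use 3 order in \<open>auto simp: quot_set_def\<close>)
  next
    case (glue1 q)
    from glue[OF this] obtain y where y: "y \<in> Obj C" "Hom C y x \<noteq> {}" "?f q = cat_class C y"
      by blast
    then have "below (?cl y)"
      using below_cl by blast
    then show ?case
      using y by (simp add: below_def conn_def quot_set_def carrier_cat_poset)
  next
    case (glue2 q)
    from glue[OF this] obtain y where y: "y \<in> Obj C" "Hom C y x \<noteq> {}" "?f q = cat_class C y"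
      by blast
    have "conn (?cl y)"
      using y Ident_in[OF y(1)] unfolding conn_cl[OF y(1)] by blast
    then show ?case
      using y by (simp add: below_def quot_set_def carrier_cat_poset)
  next
    case (trans u v w)
    have "Hom C y z \<noteq> {}"
      if yz: "y \<in> Obj C" "z \<in> Obj C" "u = ?cl y" "w = ?cl z" and "\<not> below u" for y z
    proof -
      have v: "\<not> below v"
        using trans.IH(1) \<open>\<not> below u\<close> by simp
      then obtain X where "v = Some X" "X \<in> carrier ?P"
        using trans.IH(1) by (auto simp: below_def quot_set_def)
      then obtain v' where v': "v' \<in> Obj C" "v = ?cl v'"
        by (auto simp: carrier_cat_poset)
      have "Hom C y v' \<noteq> {}"
        using trans.IH(1) yz v' \<open>\<not> below u\<close> by simp
      moreover have "Hom C v' z \<noteq> {}"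
        using trans.IH(2) yz v' v by simp
      ultimately show ?thesis
        by (rule comp)
    qed
    then have 3: "\<forall>y z. y \<in> Obj C \<and> z \<in> Obj C \<and> u = ?cl y \<and> w = ?cl z \<and> \<not> below u
        \<longrightarrow> Hom C y z \<noteq> {}"
      by (intro allI impI) (elim conjE)
    show ?case
      by (intro conjI 3) (use trans.IH in simp_all)
  qed
  have in_set: "None \<in> quot_set ?P" "y \<in> Obj C \<Longrightarrow> ?cl y \<in> quot_set ?P" for y
    by (simp_all add: quot_set_def carrier_cat_poset)
  note le = poset_quotient_le_iff[OF P]
  note defs = pi0_def pi0_point_def pi0_class_def
  show "pi0_point C x \<sqsubseteq>\<^bsub>pi0 C x\<^esub> pi0_point C x"
    unfolding defs le[OF in_set(1) in_set(1)] by (rule quot_le.point)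
  show "pi0_point C x \<sqsubseteq>\<^bsub>pi0 C x\<^esub> pi0_class C x (Some (cat_class C y))
      \<longleftrightarrow> (\<exists>z \<in> Obj C. Hom C z x \<noteq> {} \<and> Hom C z y \<noteq> {})" if y: "y \<in> Obj C"
  proof -
    have "quot_le ?P ?Q ?f None (?cl y) \<longleftrightarrow> conn (?cl y)"
    proof
      show "conn (?cl y)" if "quot_le ?P ?Q ?f None (?cl y)"
        using inv[OF that] by (simp add: conn_def)
      show "quot_le ?P ?Q ?f None (?cl y)" if "conn (?cl y)"
      proof -
        obtain z where z: "z \<in> Obj C" "Hom C z x \<noteq> {}" "Hom C z y \<noteq> {}"
          using \<open>conn (?cl y)\<close> unfolding conn_cl[OF y] by blast
        show ?thesis
          by (rule quot_le.trans[OF glued(2)[OF z(2)] ord[OF z(1) y z(3)]])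
      qed
    qed
    then show ?thesis
      unfolding defs le[OF in_set(1) in_set(2)[OF y]] conn_cl[OF y] .
  qed
  show "pi0_class C x (Some (cat_class C y)) \<sqsubseteq>\<^bsub>pi0 C x\<^esub> pi0_point C x \<longleftrightarrow> Hom C y x \<noteq> {}"
    if y: "y \<in> Obj C"
  proof -
    have "quot_le ?P ?Q ?f (?cl y) None \<longleftrightarrow> below (?cl y)"
    proof
      show "below (?cl y)" if "quot_le ?P ?Q ?f (?cl y) None"
        using inv[OF that] by (simp add: below_def)
      show "quot_le ?P ?Q ?f (?cl y) None" if "below (?cl y)"
        using that unfolding below_cl[OF y] by (rule glued(1))
    qed
    then show ?thesis
      unfolding defs le[OF in_set(2)[OF y] in_set(1)] below_cl[OF y] .
  qed
  show "pi0_class C x (Some (cat_class C y)) \<sqsubseteq>\<^bsub>pi0 C x\<^esub> pi0_class C x (Some (cat_class C z))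
      \<longleftrightarrow> Hom C y z \<noteq> {}" if y: "y \<in> Obj C" and z: "z \<in> Obj C" and "Hom C y x = {}"
  proof -
    have "quot_le ?P ?Q ?f (?cl y) (?cl z) \<longleftrightarrow> Hom C y z \<noteq> {}"
    proof
      have "\<not> below (?cl y)"
        unfolding below_cl[OF y] using \<open>Hom C y x = {}\<close> by simp
      then show "Hom C y z \<noteq> {}" if "quot_le ?P ?Q ?f (?cl y) (?cl z)"
        using inv[OF that] y z by simp
    qed (rule ord[OF y z])
    then show ?thesis
      unfolding defs le[OF in_set(2)[OF y] in_set(2)[OF z]] .
  qed
qed

lemma carrier_pi0:
  "carrier (pi0 C x) =
     insert (pi0_point C x) ((\<lambda>y. pi0_class C x (Some (cat_class C y))) ` Obj C)"
  by (auto simp: pi0_def pi0_point_def pi0_class_def carrier_poset_quotient quot_set_def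
      carrier_cat_poset)

lemma partial_order_pi0: "category C \<Longrightarrow> partial_order (pi0 C x)"
  unfolding pi0_def
  by (intro partial_order_poset_quotient partial_order.axioms(1) partial_order_cat_poset)

lemma pi0_class_eq_point_iff:
  assumes C: "category C" and x: "x \<in> Obj C" and y: "y \<in> Obj C"
  shows "pi0_class C x (Some (cat_class C y)) = pi0_point C x \<longleftrightarrow> Hom C y x \<noteq> {}"
proof -
  interpret category C by fact
  interpret pi0: partial_order "pi0 C x" by (rule partial_order_pi0) fact
  have "pi0_point C x \<sqsubseteq>\<^bsub>pi0 C x\<^esub> pi0_class C x (Some (cat_class C y))" if "Hom C y x \<noteq> {}"
    using that Ident_in[OF y] y pi0_le_iff(2)[OF C x y] by blast
  then show ?thesis
    using pi0_le_iff(1,3)[OF C x] y pi0.le_antisym carrier_pi0 by (metis image_eqI insert_iff)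
qed

end

theory Submission
  imports Defs
begin

text \<open>
  Both homotopy posets are trivial iff every object of the category in question has a morphism to
  the base object. For \<open>\<pi>\<^sub>0(C/x)\<close> this is existence of morphisms \<open>y \<rightarrow> x\<close>. For \<open>\<pi>\<^sub>1(C/x)\<close> it is their
  uniqueness, because a morphism \<open>h\<close> from \<open>(f\<^sub>0, f\<^sub>1)\<close> to \<open>(id\<^sub>x, id\<^sub>x)\<close> satisfies \<open>f\<^sub>0 = h = f\<^sub>1\<close>.
\<close>

text \<open>Each element other than the base point is the class of an object, and such a class
  collapses to the base point exactly when the object maps to \<open>x\<close>.\<close>

lemma carrier_pi0_trivial_iff:
  assumes "category C" and "x \<in> Obj C"
  shows "carrier (pi0 C x) = {pi0_point C x} \<longleftrightarrow> (\<forall>y \<in> Obj C. Hom C y x \<noteq> {})"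
proof -
  have "carrier (pi0 C x) = {pi0_point C x} \<longleftrightarrow>
      (\<forall>y \<in> Obj C. pi0_class C x (Some (cat_class C y)) = pi0_point C x)"
    unfolding carrier_pi0 by blast
  then show ?thesis
    using pi0_class_eq_point_iff[OF assms] by simp
qed

lemma Obj_Par_pair: "(f, g) \<in> Obj (Par C x) \<longleftrightarrow> (\<exists>y. f \<in> Hom C y x \<and> g \<in> Hom C y x)"
  by (simp add: Par_simps(1))

lemma (in category) Ident_pair_in_Par:
  assumes "x \<in> Obj C"
  shows "(Ident C x, Ident C x) \<in> Obj (Par C x)"
  using Ident_in[OF assms] by (auto simp: Obj_Par_pair)

text \<open>If \<open>f = g\<close>, then \<open>f\<close> itself is a morphism to the identity
  pair, by the right unit law.\<close>

lemma (in category) Hom_Par_Ident_iff: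
  assumes x: "x \<in> Obj C" and fg: "(f, g) \<in> Obj (Par C x)"
  shows "Hom (Par C x) (f, g) (Ident C x, Ident C x) \<noteq> {} \<longleftrightarrow> f = g"
proof -
  have dom: "Dom C (Ident C x) = x"
    using Ident_in[OF x] by (simp add: Hom_def)
  have f: "f \<in> Hom C (Dom C f) x"
    using fg by (simp add: Obj_Par)
  show ?thesis
    using fg f Ident_right[of _ _ x] Ident_pair_in_Par[OF x]
    by (force simp: ex_in_conv[symmetric] Hom_Par dom)
qed

lemma (in category) carrier_pi1_trivial_iff:
  assumes x: "x \<in> Obj C"
  shows "carrier (pi1 C x) = {pi1_point C x} \<longleftrightarrow>
    (\<forall>y. \<forall>f \<in> Hom C y x. \<forall>g \<in> Hom C y x. f = g)"
proof -
  have "carrier (pi1 C x) = {pi1_point C x} \<longleftrightarrow>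
      (\<forall>p \<in> Obj (Par C x). Hom (Par C x) p (Ident C x, Ident C x) \<noteq> {})"
    unfolding pi1_def pi1_point_def
    by (intro carrier_pi0_trivial_iff category_Par category_axioms Ident_pair_in_Par x)
  also have "\<dots> \<longleftrightarrow> (\<forall>(f, g) \<in> Obj (Par C x). f = g)"
    using Hom_Par_Ident_iff[OF x] by (intro ball_cong) auto
  also have "\<dots> \<longleftrightarrow> (\<forall>y. \<forall>f \<in> Hom C y x. \<forall>g \<in> Hom C y x. f = g)"
    by (auto simp: Par_simps(1))
  finally show ?thesis .
qed

theorem corollary1:
  fixes C :: "('o, 'a) category" and x :: 'o
  assumes "category C" and "x \<in> Obj C"
  shows "(carrier (pi0 C x) = {pi0_point C x} \<and> carrier (pi1 C x) = {pi1_point C x})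
    \<longleftrightarrow> terminal C x"
proof -
  interpret category C by fact
  \<comment> \<open>The condition from \<open>pi1\<close> ranges over all \<open>y\<close>, but
    \<open>terminal\<close> only over objects; any \<open>y\<close> with an arrow to
    \<open>x\<close> is an object.\<close>
  have Obj: "y \<in> Obj C" if "f \<in> Hom C y x" for f y
    using that Dom_in by (auto simp: Hom_def)
  show ?thesis
    unfolding carrier_pi0_trivial_iff[OF assms] carrier_pi1_trivial_iff[OF assms(2)] terminal_def
    using assms(2) Obj by blast
qed

end
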